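(* Let $\mathbf{f}$ be the Fibonacci word and, for $s\ge1$, let $g_s$ be its prefix of length $F_{s+2}-2$. For $s\ge4$ put $x=g_s$, $n=|x|$, $e=\operatorname{ice}(x)$. Then $\operatorname{nnp}(x)=s-2$, and $$\frac{e}{2}+1+\frac{\ln(n/2)}{\ln(e/(e-1))} - (s+c) \to 0 \quad (s\to\infty),$$ where $c = 3 + \tau^2/2 - \ln(2\sqrt5)/\ln\tau \approx 1.19632$ and $\tau=(1+\sqrt5)/2$.
   Context: The Fibonacci numbers are $F_0=0$, $F_1=1$, $F_n=F_{n-1}+F_{n-2}$. The Fibonacci word $\mathbf{f}=01001010\cdots$ is the fixed point of the morphism $0\mapsto01$, $1\mapsto0$. For a finite nonempty word $w$, an integer $p$ with $1\le p\le|w|$ is a period if $w[i]=w[i+p]$ for $1\le i\le |w|-p$; it is nontrivial if $p<|w|$; $\operatorname{nnp}(w)$ is the number of nontrivial periods; $\operatorname{per}(w)$ the least period; $\exp(w)=|w|/\operatorname{per}(w)$; $\operatorname{ice}(w)=\sup\{\exp(u): u \text{ a nonempty prefix of } w\}$. *)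

theory Defs
  imports Complex_Main "HOL-Library.Sublist" "HOL-Number_Theory.Fib"
begin

datatype letter = L0 | L1

fun fib_morph_letter :: "letter \<Rightarrow> letter list" where
  "fib_morph_letter L0 = [L0, L1]"
| "fib_morph_letter L1 = [L0]"

definition fib_morph :: "letter list \<Rightarrow> letter list" where
  "fib_morph w = concat (map fib_morph_letter w)"

definition word_prefix :: "(nat \<Rightarrow> 'a) \<Rightarrow> nat \<Rightarrow> 'a list" where
  "word_prefix a n = map a [0..<n]"

text \<open>The image of an infinite word is the infinite word all of whose prefixes come from images
  of finite prefixes; being fixed therefore means that the image of every finite prefix of
  the word is again a prefix of the word.\<close>

definition fib_morph_fixed :: "(nat \<Rightarrow> letter) \<Rightarrow> bool" where
  "fib_morph_fixed a \<longleftrightarrow>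
     (\<forall>n. fib_morph (word_prefix a n) = word_prefix a (length (fib_morph (word_prefix a n))))"

text \<open>The description is proper: see \<open>ex1_fib_morph_fixed\<close> below.\<close>

definition fib_word :: "nat \<Rightarrow> letter" where
  "fib_word = (THE a. fib_morph_fixed a)"

definition fib_prefix :: "nat \<Rightarrow> letter list" where
  "fib_prefix s = word_prefix fib_word (fib (s + 2) - 2)"

text \<open>Positions are counted from \<open>0\<close>.\<close>

definition is_period :: "'a list \<Rightarrow> nat \<Rightarrow> bool" where
  "is_period w p \<longleftrightarrow> 1 \<le> p \<and> p \<le> length w \<and> (\<forall>i < length w - p. w ! i = w ! (i + p))"

definition nnp :: "'a list \<Rightarrow> nat" where
  "nnp w = card {p. is_period w p \<and> p < length w}"

definition per :: "'a list \<Rightarrow> nat" where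
  "per w = (LEAST p. is_period w p)"

definition word_exp :: "'a list \<Rightarrow> real" where
  "word_exp w = real (length w) / real (per w)"

definition ice :: "'a list \<Rightarrow> real" where
  "ice w = Sup {word_exp u | u. u \<noteq> [] \<and> prefix u w}"

lemma length_word_prefix [simp]: "length (word_prefix a n) = n"
  by (simp add: word_prefix_def)

lemma nth_word_prefix [simp]: "i < n \<Longrightarrow> word_prefix a n ! i = a i"
  by (simp add: word_prefix_def)

lemma fib_morph_append: "fib_morph (u @ v) = fib_morph u @ fib_morph v"
  by (simp add: fib_morph_def)

lemma fib_morph_prefix: "prefix u v \<Longrightarrow> prefix (fib_morph u) (fib_morph v)"
  by (auto simp: prefix_def fib_morph_append)

definition fib_iter :: "nat \<Rightarrow> letter list" where
  "fib_iter k = (fib_morph ^^ k) [L0]"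

lemma fib_iter_0: "fib_iter 0 = [L0]"
  and fib_iter_Suc: "fib_iter (Suc k) = fib_morph (fib_iter k)"
  by (simp_all add: fib_iter_def)

lemma fib_iter_prefix_Suc: "prefix (fib_iter k) (fib_iter (Suc k))"
proof (induction k)
  case 0
  show ?case by (simp add: fib_iter_Suc fib_iter_0 fib_morph_def)
next
  case (Suc k)
  then show ?case by (metis fib_iter_Suc fib_morph_prefix)
qed

lemma fib_iter_prefix: "k \<le> m \<Longrightarrow> prefix (fib_iter k) (fib_iter m)"
  by (induction rule: dec_induct) (auto intro: fib_iter_prefix_Suc prefix_order.trans)

lemma length_fib_morph_ge: "length w \<le> length (fib_morph w)"
proof (induction w)
  case (Cons x w)
  then show ?case by (cases x) (auto simp: fib_morph_def)
qed (simp add: fib_morph_def)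

lemma length_fib_iter: "k < length (fib_iter k)"
proof (induction k)
  case 0
  show ?case by (simp add: fib_iter_0)
next
  case (Suc k)
  have "prefix [L0] (fib_iter k)"
    using fib_iter_prefix[of 0 k] by (simp add: fib_iter_0)
  then obtain v where v: "fib_iter k = L0 # v" by (auto simp: prefix_def)
  have "length (fib_iter (Suc k)) = 2 + length (fib_morph v)"
    by (simp add: fib_iter_Suc v fib_morph_def)
  with length_fib_morph_ge[of v] Suc v show ?case by simp
qed

lemma fib_iter_nth:
  assumes "i < length (fib_iter k)"
  shows "fib_iter k ! i = fib_iter i ! i"
proof (cases "k \<le> i")
  case True
  from fib_iter_prefix[OF this] obtain v where "fib_iter i = fib_iter k @ v"
    by (auto simp: prefix_def)
  with assms show ?thesis by (simp add: nth_append)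
next
  case False
  from fib_iter_prefix[of i k] False obtain v where "fib_iter k = fib_iter i @ v"
    by (auto simp: prefix_def)
  with length_fib_iter[of i] show ?thesis by (simp add: nth_append)
qed

lemma prefix_word_prefix:
  assumes "prefix u (word_prefix a n)"
  shows "u = word_prefix a (length u)"
proof -
  from assms obtain v where v: "word_prefix a n = u @ v" by (auto simp: prefix_def)
  show ?thesis
  proof (rule nth_equalityI)
    fix i assume i: "i < length u"
    have "length u \<le> n" using arg_cong[OF v, of length] by simp
    with i have "word_prefix a n ! i = a i" by simp
    with v i show "u ! i = word_prefix a (length u) ! i" by (simp add: nth_append)
  qed simp
qed

lemma word_prefix_mono: "m \<le> n \<Longrightarrow> prefix (word_prefix a m) (word_prefix a n)"
  by (metis length_word_prefix prefix_word_prefix take_is_prefix length_take min.absorb2)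

lemma fib_iter_fixed:
  assumes "fib_morph_fixed a"
  shows "fib_iter k = word_prefix a (length (fib_iter k))"
proof (induction k)
  case 0
  have "fib_morph (word_prefix a 1) = word_prefix a (length (fib_morph (word_prefix a 1)))"
    using assms by (simp only: fib_morph_fixed_def)
  then have "a 0 = L0"
    by (cases "a 0") (auto simp: word_prefix_def fib_morph_def upt_conv_Cons)
  then show ?case by (simp add: fib_iter_0 word_prefix_def)
next
  case (Suc k)
  have "fib_morph (word_prefix a n) = word_prefix a (length (fib_morph (word_prefix a n)))" for n
    using assms by (simp only: fib_morph_fixed_def)
  then show ?case using Suc by (metis fib_iter_Suc)
qed

lemma ex1_fib_morph_fixed: "\<exists>!a. fib_morph_fixed a"
proof (rule ex1I)
  define f where "f = (\<lambda>i. fib_iter i ! i)"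
  have pre: "fib_iter k = word_prefix f (length (fib_iter k))" for k
    by (rule nth_equalityI) (simp_all add: f_def fib_iter_nth)
  show "fib_morph_fixed f"
    unfolding fib_morph_fixed_def
  proof
    fix n
    have "prefix (word_prefix f n) (fib_iter n)"
      using word_prefix_mono[of n "length (fib_iter n)" f] pre[of n] length_fib_iter[of n] by simp
    then have "prefix (fib_morph (word_prefix f n)) (fib_iter (Suc n))"
      by (simp add: fib_iter_Suc fib_morph_prefix)
    then show "fib_morph (word_prefix f n) =
        word_prefix f (length (fib_morph (word_prefix f n)))"
      using pre[of "Suc n"] prefix_word_prefix by metis
  qed
  fix a assume a: "fib_morph_fixed a"
  show "a = f"
  proof
    fix i
    show "a i = f i"
      using fib_iter_fixed[OF a, of i] length_fib_iter[of i]
      by (metis f_def nth_word_prefix)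
  qed
qed

end

theory Submission
  imports Defs "HOL-Analysis.Harmonic_Numbers"
begin

text \<open>
  Write \<open>F\<close> for the Fibonacci numbers and \<open>n\<^sub>s = F\<^sub>s\<^sub>+\<^sub>2 - 2\<close> for the length of \<open>g\<^sub>s\<close>. The word
  \<open>g\<^sub>s\<^sub>+\<^sub>1\<close> has period \<open>F\<^sub>s\<^sub>+\<^sub>1\<close>, i.e. border \<open>g\<^sub>s\<close>. No smaller period survives: a smaller period
  of the prefix of length \<open>n\<^sub>s + 1\<close> would be a period of \<open>g\<^sub>s\<close> below \<open>F\<^sub>s\<^sub>+\<^sub>1\<close>, which by induction
  can only be \<open>F\<^sub>s\<close>, and this one breaks at position \<open>n\<^sub>s\<close> because the letters at the positions
  \<open>F\<^sub>m - 2\<close> alternate. Hence the borders of \<open>g\<^sub>s\<close> are exactly the \<open>g\<^sub>j\<close> with \<open>j < s\<close>, and the least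
  period of every prefix is known, which gives \<open>e = n\<^sub>s / F\<^sub>s\<close>.

  Consequently \<open>e / (e - 1) = n\<^sub>s / n\<^sub>s\<^sub>-\<^sub>1\<close>. By Binet's formula
  \<open>ln n\<^sub>s = (s + 2) ln \<tau> - ln (sqrt 5) + h\<^sub>s\<close> with \<open>s h\<^sub>s \<rightarrow> 0\<close>, and so the error of \<open>ln (e / (e - 1))\<close>
  against \<open>ln \<tau>\<close> is negligible even after multiplication by \<open>s\<close>.
\<close>

section \<open>Self-similarity of the Fibonacci word\<close>

lemma fib_iter_add_two: "fib_iter (k + 2) = fib_iter (k + 1) @ fib_iter k"
proof (induction k)
  case 0
  show ?case by (simp add: numeral_2_eq_2 fib_iter_Suc fib_iter_0 fib_morph_def)
next
  case (Suc k)
  then show ?case by (simp add: fib_iter_Suc fib_morph_append)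
qed

lemma length_fib_iter_eq_fib: "length (fib_iter k) = fib (k + 2)"
proof (induction k rule: fib.induct)
  case (3 k)
  then show ?case using fib_iter_add_two[of k] by simp
qed (simp_all add: fib_iter_Suc fib_iter_0 fib_morph_def numeral_3_eq_3)

lemma fib_iter_eq_word_prefix: "fib_iter k = word_prefix fib_word (fib (k + 2))"
proof -
  have "fib_morph_fixed fib_word"
    unfolding fib_word_def by (rule theI'[OF ex1_fib_morph_fixed])
  from fib_iter_fixed[OF this, of k] show ?thesis
    by (simp add: length_fib_iter_eq_fib)
qed

text \<open>In \<open>fib_iter (k + 2)\<close> the factor \<open>fib_iter k\<close>, itself a prefix
  of the word, starts right after \<open>fib_iter (k + 1)\<close>, at position
  \<open>fib (k + 3)\<close>.\<close>

lemma fib_word_shift: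
  assumes "i < fib (k + 2)"
  shows "fib_word (fib (k + 3) + i) = fib_word i"
proof -
  have "fib_iter (k + 2) ! (fib (k + 3) + i) = fib_iter k ! i"
    unfolding fib_iter_add_two nth_append length_fib_iter_eq_fib
    by (simp add: numeral_3_eq_3 del: fib.simps)
  moreover have "fib_iter (k + 2) ! (fib (k + 3) + i) = fib_word (fib (k + 3) + i)"
    unfolding fib_iter_eq_word_prefix using assms
    by (intro nth_word_prefix) (simp add: eval_nat_numeral)
  moreover have "fib_iter k ! i = fib_word i"
    unfolding fib_iter_eq_word_prefix using assms by (intro nth_word_prefix)
  ultimately show ?thesis by simp
qed

text \<open>The range is the longest possible: at \<open>i = fib (k + 3) - 2\<close> the two letters
  differ, by the alternation at the positions \<open>fib m - 2\<close>.\<close>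

lemma fib_word_period_fib:
  assumes "i + 2 < fib (k + 3)"
  shows "fib_word (fib (k + 2) + i) = fib_word i"
  using assms
proof (induction k arbitrary: i)
  case 0
  then show ?case by (simp add: eval_nat_numeral)
next
  case (Suc k)
  show ?case
  proof (cases "i < fib (k + 2)")
    case True
    then show ?thesis using fib_word_shift[of i k] by (simp add: eval_nat_numeral)
  next
    case False
    \<comment> \<open>Beyond the reach of \<open>fib_word_shift\<close> at level \<open>k\<close>,
      the same lemma one level up sends the position to \<open>j\<close>, and the induction
      hypothesis carries \<open>j\<close> back to \<open>i\<close>.\<close>
    define j where "j = i - fib (k + 2)"
    have i: "i = fib (k + 2) + j" using False by (simp add: j_def)
    have j: "j + 2 < fib (k + 3)" using Suc.prems by (simp add: i eval_nat_numeral)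
    have "j < fib (Suc k + 2)" using j by (simp add: eval_nat_numeral)
    moreover have "fib (Suc k + 2) + i = fib (Suc k + 3) + j" by (simp add: i eval_nat_numeral)
    ultimately have "fib_word (fib (Suc k + 2) + i) = fib_word j"
      using fib_word_shift[of j "Suc k"] by metis
    also have "\<dots> = fib_word i" using Suc.IH[OF j] by (simp add: i)
    finally show ?thesis .
  qed
qed

lemma fib_ge_two: "2 \<le> fib (k + 3)"
  using fib_mono[of 3 "k + 3"] by (simp add: eval_nat_numeral)

text \<open>Raising \<open>k\<close> by two moves the position by \<open>fib (k + 4)\<close>, and
  \<open>fib_word_shift\<close> copies the letter; hence only the parity matters.\<close>

lemma fib_word_fib_minus_two: "fib_word (fib (k + 3) - 2) = (if even k then L0 else L1)"
proof (induction k rule: fib.induct)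
  case 1
  have "word_prefix fib_word (fib (0 + 2)) ! 0 = L0"
    unfolding fib_iter_eq_word_prefix[symmetric] by (simp add: fib_iter_0)
  then show ?case by (simp add: eval_nat_numeral)
next
  case 2
  have "word_prefix fib_word (fib (1 + 2)) ! 1 = L1"
    unfolding fib_iter_eq_word_prefix[symmetric]
    by (simp add: fib_iter_Suc fib_iter_0 fib_morph_def)
  then show ?case by (simp add: eval_nat_numeral)
next
  case (3 k)
  have "fib (Suc (Suc k) + 3) - 2 = fib (k + 1 + 3) + (fib (k + 3) - 2)"
    using fib_ge_two[of k] by (simp add: eval_nat_numeral)
  moreover have "fib (k + 3) - 2 < fib (k + 1 + 2)"
    using fib_ge_two[of k] by (simp add: numeral_3_eq_3)
  ultimately have "fib_word (fib (Suc (Suc k) + 3) - 2) = fib_word (fib (k + 3) - 2)"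
    using fib_word_shift by metis
  then show ?case using 3(2) by (simp only: even_Suc not_not)
qed

section \<open>Periods of prefixes\<close>

definition has_prefix_period :: "(nat \<Rightarrow> 'a) \<Rightarrow> nat \<Rightarrow> nat \<Rightarrow> bool" where
  "has_prefix_period a n p \<longleftrightarrow> 1 \<le> p \<and> (\<forall>i. i + p < n \<longrightarrow> a i = a (i + p))"

lemma is_period_word_prefix:
  "is_period (word_prefix a n) p \<longleftrightarrow> p \<le> n \<and> has_prefix_period a n p"
  by (auto simp: is_period_def has_prefix_period_def less_diff_conv)

text \<open>This is why \<open>has_prefix_period\<close> omits the bound \<open>p \<le> n\<close>:
  periods then restrict to shorter prefixes with no side condition.\<close>

lemma has_prefix_period_mono:
  "has_prefix_period a n p \<Longrightarrow> m \<le> n \<Longrightarrow> has_prefix_period a m p"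
  by (auto simp: has_prefix_period_def)

text \<open>A period \<open>p\<close> leaves a border of length \<open>n - p\<close>, and a border
  of a border is again a border. The next lemma is the converse.\<close>

lemma has_prefix_period_add:
  assumes "has_prefix_period a n p" "has_prefix_period a (n - p) q"
  shows "has_prefix_period a n (p + q)"
  unfolding has_prefix_period_def
proof (intro conjI allI impI)
  fix i assume i: "i + (p + q) < n"
  then have "a i = a (i + q)"
    using assms(2) by (auto simp: has_prefix_period_def)
  also have "\<dots> = a (i + q + p)"
    using assms(1) i by (auto simp: has_prefix_period_def)
  finally show "a i = a (i + (p + q))" by (simp add: ac_simps)
qed (use assms in \<open>auto simp: has_prefix_period_def\<close>)

lemma has_prefix_period_diff:
  assumes "has_prefix_period a n p" "has_prefix_period a n (p + q)" "1 \<le> q"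
  shows "has_prefix_period a (n - p) q"
  unfolding has_prefix_period_def
proof (intro conjI allI impI)
  fix i assume i: "i + q < n - p"
  then have "a i = a (i + (p + q))"
    using assms(2) by (auto simp: has_prefix_period_def)
  also have "\<dots> = a (i + q + p)" by (simp add: ac_simps)
  also have "\<dots> = a (i + q)"
    using assms(1) i by (auto simp: has_prefix_period_def)
  finally show "a i = a (i + q)" .
qed (fact assms)

lemma has_prefix_period_fib_word:
  "has_prefix_period fib_word (fib (k + 4) - 2) (fib (k + 2))"
  using fib_word_period_fib[of _ k] fib_neq_0_nat[of "k + 2"]
  by (auto simp: has_prefix_period_def eval_nat_numeral add.commute)

lemma fib_strict_mono:
  assumes "2 \<le> m" "m < n"
  shows "fib m < fib n"
proof -
  obtain k where k: "m = Suc k" "k > 0" using assms(1) by (cases m) auto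
  have "fib m < fib (Suc m)" using fib_neq_0_nat[of k] k by simp
  also have "\<dots> \<le> fib n" using assms by (intro fib_mono) simp
  finally show ?thesis .
qed

text \<open>The list of periods enters as a hypothesis, so that the lemma serves both inside the
  induction proving \<open>fib_word_periods\<close>, where only the induction hypothesis is
  available, and after it.\<close>

lemma least_period_beyond_fib:
  assumes periods: "\<And>p. p \<le> fib (k + 3) - 2 \<Longrightarrow> has_prefix_period fib_word (fib (k + 3) - 2) p \<Longrightarrow>
      \<exists>j\<in>{1..k}. p = fib (k + 3) - fib (j + 2)"
    and p: "has_prefix_period fib_word (fib (k + 3) - 1) p"
  shows "fib (k + 2) \<le> p"
proof (rule ccontr)
  assume "\<not> ?thesis"
  then have less: "p < fib (k + 2)" by simp
  have p1: "1 \<le> p" using p by (simp add: has_prefix_period_def)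
  have "k \<noteq> 0" using less p1 by (intro notI) simp
  then obtain l where k: "k = Suc l" by (cases k) auto
  have "1 \<le> fib (k + 1)" using fib_neq_0_nat[of "k + 1"] by simp
  then have "p \<le> fib (k + 3) - 2" using less by (simp add: eval_nat_numeral)
  moreover have "has_prefix_period fib_word (fib (k + 3) - 2) p"
    by (rule has_prefix_period_mono[OF p]) simp
  ultimately obtain j where j: "j \<in> {1..k}" "p = fib (k + 3) - fib (j + 2)"
    using periods by blast
  \<comment> \<open>A smaller \<open>j\<close> would give
    \<open>p \<ge> fib (k + 3) - fib (k + 1) = fib (k + 2)\<close>.\<close>
  have "j = k"
  proof (rule ccontr)
    assume "j \<noteq> k"
    then have "fib (j + 2) \<le> fib (k + 1)" using j by (intro fib_mono) simp
    then show False using j less by (simp add: eval_nat_numeral)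
  qed
  then have peq: "p = fib (k + 1)" using j by (simp add: eval_nat_numeral)
  \<comment> \<open>The period compares the last letter of the prefix with the one at
    \<open>fib (k + 2) - 2\<close>; these are consecutive alternating positions.\<close>
  have "fib (k + 2) - 2 + p < fib (k + 3) - 1" "fib (k + 2) - 2 + p = fib (k + 3) - 2"
    using fib_ge_two[of l] by (simp_all add: peq k eval_nat_numeral)
  then have "fib_word (fib (k + 2) - 2) = fib_word (fib (k + 3) - 2)"
    using p by (metis has_prefix_period_def)
  moreover have "k + 2 = l + 3" "k + 3 = Suc l + 3" by (simp_all add: k)
  ultimately have "(if even l then L0 else L1) = (if even (Suc l) then L0 else L1)"
    using fib_word_fib_minus_two[of l] fib_word_fib_minus_two[of "Suc l"] by metis
  then show False by (simp split: if_splits)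
qed

text \<open>The period indexed by \<open>j\<close> has the border of length
  \<open>fib (j + 2) - 2\<close>. The index \<open>j = 1\<close> is the empty border, i.e. the
  trivial period, which keeps the induction uniform.\<close>

lemma fib_word_periods:
  "p \<le> fib (k + 3) - 2 \<and> has_prefix_period fib_word (fib (k + 3) - 2) p \<longleftrightarrow>
     (\<exists>j\<in>{1..k}. p = fib (k + 3) - fib (j + 2))"
proof (induction k arbitrary: p)
  case 0
  then show ?case by (auto simp: has_prefix_period_def eval_nat_numeral)
next
  case (Suc k)
  let ?n = "fib (Suc k + 3) - 2"
  have per: "has_prefix_period fib_word ?n (fib (k + 2))"
    using has_prefix_period_fib_word[of k] by (simp add: eval_nat_numeral)
  have n: "?n - fib (k + 2) = fib (k + 3) - 2" "?n = fib (k + 2) + (fib (k + 3) - 2)"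
    using fib_ge_two[of k] by (simp_all add: eval_nat_numeral)
  have split: "{1..Suc k} = insert (Suc k) {1..k}" by auto
  have top: "fib (Suc k + 3) - fib (Suc k + 2) = fib (k + 2)"
    by (simp add: eval_nat_numeral)
  have shift: "fib (Suc k + 3) - fib (j + 2) = fib (k + 2) + (fib (k + 3) - fib (j + 2))"
    if "j \<in> {1..k}" for j
    using that fib_mono[of "j + 2" "k + 3"] by (simp add: eval_nat_numeral)
  show ?case
  proof
    assume p: "p \<le> ?n \<and> has_prefix_period fib_word ?n p"
    have "fib (k + 2) \<le> p"
    proof (rule least_period_beyond_fib)
      have "1 \<le> fib (k + 2)" using fib_mono[of 1 "k + 2"] by simp
      then have "fib (k + 3) - 1 \<le> ?n"
        using fib_ge_two[of k] n by simp
      then show "has_prefix_period fib_word (fib (k + 3) - 1) p"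
        using p has_prefix_period_mono by blast
    qed (rule iffD1[OF Suc.IH conjI])
    \<comment> \<open>Removing the least period leaves a period of the longest proper border, to
      which the induction hypothesis applies.\<close>
    then obtain q where q: "p = fib (k + 2) + q" using le_Suc_ex by blast
    show "\<exists>j\<in>{1..Suc k}. p = fib (Suc k + 3) - fib (j + 2)"
    proof (cases "q = 0")
      case True
      then show ?thesis using q top by force
    next
      case False
      then have "has_prefix_period fib_word (fib (k + 3) - 2) q"
        using has_prefix_period_diff[OF per, of q] p q n by simp
      moreover have "q \<le> fib (k + 3) - 2" using p q n by simp
      ultimately obtain j where "j \<in> {1..k}" "q = fib (k + 3) - fib (j + 2)"
        using Suc.IH by blast
      then show ?thesis using shift q split by auto
    qed
  next
    assume "\<exists>j\<in>{1..Suc k}. p = fib (Suc k + 3) - fib (j + 2)"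
    then consider "p = fib (k + 2)" |
      j where "j \<in> {1..k}" "p = fib (k + 2) + (fib (k + 3) - fib (j + 2))"
      using shift top split by auto
    then show "p \<le> ?n \<and> has_prefix_period fib_word ?n p"
    proof cases
      case 1
      then show ?thesis using per n by simp
    next
      case 2
      define q where "q = fib (k + 3) - fib (j + 2)"
      have "q \<le> fib (k + 3) - 2 \<and> has_prefix_period fib_word (fib (k + 3) - 2) q"
        unfolding Suc.IH q_def using 2 by blast
      then show ?thesis
        using 2 has_prefix_period_add[OF per, of q] n by (simp add: q_def)
    qed
  qed
qed

lemma fib_le_period:
  assumes "has_prefix_period fib_word n p" "fib (k + 3) - 2 < n"
  shows "fib (k + 2) \<le> p"
proof (rule least_period_beyond_fib)
  show "has_prefix_period fib_word (fib (k + 3) - 1) p"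
    by (rule has_prefix_period_mono[OF assms(1)]) (use assms(2) in linarith)
  show "\<exists>j\<in>{1..k}. q = fib (k + 3) - fib (j + 2)"
    if "q \<le> fib (k + 3) - 2" "has_prefix_period fib_word (fib (k + 3) - 2) q" for q
    using iffD1[OF fib_word_periods conjI[OF that]] .
qed

text \<open>Dropping the trivial period \<open>j = 1\<close> leaves the indices from 2 to
  \<open>s - 1\<close>, which give distinct periods.\<close>

lemma nnp_fib_prefix:
  assumes "2 \<le> s"
  shows "nnp (fib_prefix s) = s - 2"
proof -
  obtain k where s: "s = k + 2" using assms by (metis add.commute le_Suc_ex)
  have "{p. is_period (fib_prefix s) p \<and> p < length (fib_prefix s)} =
      (\<lambda>j. fib (s + 2) - fib (j + 2)) ` {2..k + 1}"
  proof -
    have "is_period (fib_prefix s) p \<and> p < length (fib_prefix s) \<longleftrightarrow>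
        (\<exists>j\<in>{1..k + 1}. p = fib (s + 2) - fib (j + 2)) \<and> p < fib (s + 2) - 2" for p
      using fib_word_periods[of p "k + 1"]
      by (auto simp: fib_prefix_def is_period_word_prefix s numeral_eq_Suc)
    moreover have "fib (s + 2) - fib (j + 2) < fib (s + 2) - 2 \<longleftrightarrow> 2 \<le> j"
      if "j \<in> {1..k + 1}" for j
    proof -
      have "fib (j + 2) < fib (s + 2)" using that s by (intro fib_strict_mono) auto
      moreover have "2 < fib (j + 2)" if "2 \<le> j"
        using that fib_mono[of 4 "j + 2"] by (simp add: eval_nat_numeral)
      moreover have "j = 1" if "\<not> 2 \<le> j"
        using \<open>j \<in> {1..k + 1}\<close> that by simp
      ultimately show ?thesis by (cases "2 \<le> j") (auto simp: eval_nat_numeral)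
    qed
    ultimately show ?thesis by (auto simp: image_iff) 
  qed
  moreover have "inj_on (\<lambda>j. fib (s + 2) - fib (j + 2)) {2..k + 1}"
  proof (rule linorder_inj_onI)
    fix i j assume "i < j" "i \<in> {2..k + 1}" "j \<in> {2..k + 1}"
    then have "fib (i + 2) < fib (j + 2)" "fib (j + 2) < fib (s + 2)"
      using s by (simp_all del: fib.simps add_2_eq_Suc' add: fib_strict_mono)
    then show "fib (s + 2) - fib (i + 2) \<noteq> fib (s + 2) - fib (j + 2)" by simp
  qed auto
  ultimately show ?thesis by (simp add: nnp_def card_image s)
qed

section \<open>The initial critical exponent\<close>

lemma fib_exponent_mono:
  assumes "k \<le> l"
  shows "(real (fib (k + 4)) - 2) / real (fib (k + 2))
    \<le> (real (fib (l + 4)) - 2) / real (fib (l + 2))"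
  using assms
proof (rule lift_Suc_mono_le[rotated])
  fix k
  define a b where "a = real (fib (k + 2))" and "b = real (fib (k + 3))"
  have pos: "a > 0" "b > 0"
    unfolding a_def b_def of_nat_0_less_iff by (rule fib_neq_0_nat; simp)+
  have "real (fib (k + 1)) \<ge> 1"
    using fib_neq_0_nat[of "k + 1"] by simp
  then have ba: "b \<ge> a + 1" by (simp add: a_def b_def eval_nat_numeral)
  \<comment> \<open>After cross-multiplication the claim is
    \<open>b\<^sup>2 - (b + a) * a \<le> 2 * (b - a)\<close>. The left side is 1 or -1 by Cassini's
    identity, and \<open>b - a\<close> is at least 1.\<close>
  have "real_of_int (int (fib (Suc (Suc (k + 2))) * fib (k + 2)) - int ((fib (Suc (k + 2)))\<^sup>2))
      = - ((-1) ^ k)"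
    unfolding fib_Cassini_int by simp
  then have "(b + a) * a - b\<^sup>2 = - ((-1) ^ k)"
    by (simp add: a_def b_def eval_nat_numeral)
  then have "b\<^sup>2 - (b + a) * a = (-1) ^ k" by simp
  also have "\<dots> \<le> 1" by (cases "even k") auto
  also have "\<dots> \<le> 2 * (b - a)" using ba by auto
  finally have "(b + a - 2) * b \<le> (2 * b + a - 2) * a"
    by (simp add: algebra_simps power2_eq_square)
  then have "(b + a - 2) / a \<le> (2 * b + a - 2) / b"
    using pos by (simp add: divide_simps)
  then show "(real (fib (k + 4)) - 2) / real (fib (k + 2))
      \<le> (real (fib (Suc k + 4)) - 2) / real (fib (Suc k + 2))"
    by (simp add: a_def b_def eval_nat_numeral algebra_simps)
qed

lemma ice_fib_prefix:
  assumes "2 \<le> s"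
  shows "ice (fib_prefix s) = (real (fib (s + 2)) - 2) / real (fib s)"
proof -
  obtain l where s: "s = l + 2" using assms by (metis add.commute le_Suc_ex)
  define E where "E = (real (fib (l + 4)) - 2) / real (fib (l + 2))"
  have x: "fib_prefix s = word_prefix fib_word (fib (l + 4) - 2)"
    by (simp add: fib_prefix_def s numeral_eq_Suc)
  have four: "3 \<le> fib (k + 4)" for k
    using fib_mono[of 4 "k + 4"] by (simp add: eval_nat_numeral)
  have upper: "word_exp u \<le> E" if "u \<noteq> []" "prefix u (fib_prefix s)" for u
  proof -
    define n where "n = length u"
    have u: "u = word_prefix fib_word n"
      using prefix_word_prefix that(2) unfolding x n_def by blast
    have n: "0 < n" "n \<le> fib (l + 4) - 2"
      using that prefix_length_le[OF that(2)] by (simp_all add: n_def x)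
    \<comment> \<open>The shortest \<open>fib_prefix (k + 2)\<close> having \<open>u\<close> as a
      prefix; minimality puts \<open>n\<close> above \<open>fib (k + 3) - 2\<close>, as
      \<open>fib_le_period\<close> requires.\<close>
    define k where "k = (LEAST k. n \<le> fib (k + 4) - 2)"
    have k: "n \<le> fib (k + 4) - 2" "k \<le> l"
      unfolding k_def using n(2) by (rule LeastI, intro Least_le)
    have gt: "fib (k + 3) - 2 < n"
    proof (cases k)
      case 0
      then show ?thesis using n by (simp add: eval_nat_numeral)
    next
      case (Suc j)
      then have "\<not> n \<le> fib (j + 4) - 2"
        unfolding k_def by (intro not_less_Least) simp
      then show ?thesis by (simp add: Suc numeral_eq_Suc)
    qed
    have "is_period u n"
      using n by (simp add: u is_period_def)
    then have "is_period u (per u)" unfolding per_def by (rule LeastI)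
    then have "has_prefix_period fib_word n (per u)"
      using u is_period_word_prefix by metis
    then have "fib (k + 2) \<le> per u" using fib_le_period gt by blast
    moreover have pos: "0 < fib (k + 2)" by (rule fib_neq_0_nat) simp
    moreover have "real n \<le> real (fib (k + 4)) - 2" using k(1) four[of k] by linarith
    ultimately have "real n / real (per u) \<le> (real (fib (k + 4)) - 2) / real (fib (k + 2))"
      by (intro frac_le) (use four[of k] in linarith)+
    also have "\<dots> \<le> E" unfolding E_def by (rule fib_exponent_mono[OF k(2)])
    finally show ?thesis by (simp add: word_exp_def n_def)
  qed
  have nonempty: "fib_prefix s \<noteq> []"
    using four[of l] by (auto simp: x word_prefix_def)
  have "fib (l + 2) \<le> fib (l + 4) - 2"
    using fib_ge_two[of l] by (simp add: eval_nat_numeral)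
  then have "is_period (fib_prefix s) (fib (l + 2))"
    using has_prefix_period_fib_word[of l] by (simp add: x is_period_word_prefix del: fib.simps)
  \<comment> \<open>Only an upper bound on the least period is needed: it gives one inequality for
    the exponent, and \<open>upper\<close> gives the other.\<close>
  then have "is_period (fib_prefix s) (per (fib_prefix s))" "per (fib_prefix s) \<le> fib (l + 2)"
    unfolding per_def by (rule LeastI, intro Least_le)
  then have "(real (fib (l + 4)) - 2) / real (fib (l + 2))
      \<le> (real (fib (l + 4)) - 2) / real (per (fib_prefix s))"
    by (intro frac_le) (use four[of l] in \<open>auto simp: is_period_def simp del: fib.simps\<close>)
  also have "\<dots> = word_exp (fib_prefix s)"
    using four[of l] by (simp add: word_exp_def x of_nat_diff)
  finally have "word_exp (fib_prefix s) = E"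
    using upper[OF nonempty] by (simp add: E_def)
  then have "ice (fib_prefix s) = E"
    unfolding ice_def using upper nonempty by (intro cSup_eq_maximum) auto
  then show ?thesis by (simp add: E_def s numeral_eq_Suc)
qed

section \<open>Asymptotics\<close>

text \<open>Eventually \<open>\<bar>x n\<bar> \<le> 1 / 2\<close>, where the logarithm is at most
  twice \<open>\<bar>x n\<bar>\<close> in absolute value.\<close>

lemma tendsto_times_ln_one_plus:
  fixes x :: "nat \<Rightarrow> real"
  assumes "(\<lambda>n. real n * x n) \<longlonglongrightarrow> 0"
  shows "(\<lambda>n. real n * ln (1 + x n)) \<longlonglongrightarrow> 0"
proof -
  have "(\<lambda>n. 2 * \<bar>real n * x n\<bar>) \<longlonglongrightarrow> 2 * \<bar>0\<bar>"
    by (intro tendsto_intros assms)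
  then have lim: "(\<lambda>n. 2 * \<bar>real n * x n\<bar>) \<longlonglongrightarrow> 0" by simp
  then have "eventually (\<lambda>n. 2 * \<bar>real n * x n\<bar> < 1) sequentially"
    by (rule order_tendstoD) simp
  then have "eventually (\<lambda>n. norm (real n * ln (1 + x n)) \<le> 2 * \<bar>real n * x n\<bar>) sequentially"
    using eventually_ge_at_top[of 1]
  proof eventually_elim
    case (elim n)
    have "1 * \<bar>x n\<bar> \<le> real n * \<bar>x n\<bar>"
      using elim(2) by (intro mult_right_mono) auto
    then have small: "\<bar>x n\<bar> \<le> 1 / 2" using elim(1) by (simp add: abs_mult)
    have "\<bar>ln (1 + x n) - x n\<bar> \<le> 2 * (x n)\<^sup>2"
      by (rule abs_ln_one_plus_x_minus_x_bound[OF small])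
    also have "\<dots> = 2 * \<bar>x n\<bar> * \<bar>x n\<bar>" by (simp add: power2_eq_square)
    also have "\<dots> \<le> 1 * \<bar>x n\<bar>" using small by (intro mult_right_mono) auto
    finally have "\<bar>ln (1 + x n)\<bar> \<le> 2 * \<bar>x n\<bar>" by linarith
    then have "real n * \<bar>ln (1 + x n)\<bar> \<le> real n * (2 * \<bar>x n\<bar>)"
      by (intro mult_left_mono) auto
    then show ?case by (simp add: abs_mult)
  qed
  then show ?thesis using lim by (rule Lim_null_comparison)
qed

lemma ln_fib_minus_two_asymptotics:
  fixes \<tau> :: real
  defines "\<tau> \<equiv> (1 + sqrt 5) / 2"
  shows "(\<lambda>k. real k * (ln (real (fib k) - 2) - real k * ln \<tau> + ln (sqrt 5))) \<longlonglongrightarrow> 0"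
proof -
  define \<psi> where "\<psi> = (1 - sqrt 5) / 2"
  have s5: "sqrt 5 > 2" "sqrt 5 < 3" by (auto intro: real_less_rsqrt real_less_lsqrt)
  have \<tau>: "\<tau> > 1" using s5 by (simp add: \<tau>_def)
  have r: "\<bar>\<psi> / \<tau>\<bar> < 1" "\<bar>1 / \<tau>\<bar> < 1"
    using s5 \<tau> by (simp_all add: \<psi>_def \<tau>_def abs_if field_simps)
  \<comment> \<open>The relative error of \<open>\<tau> ^ k / sqrt 5\<close> as an approximation to
    \<open>fib k - 2\<close>, by Binet's formula.\<close>
  define x where "x k = - ((\<psi> / \<tau>) ^ k) - 2 * sqrt 5 * (1 / \<tau>) ^ k" for k
  have "(\<lambda>k. - (real k * (\<psi> / \<tau>) ^ k) - 2 * sqrt 5 * (real k * (1 / \<tau>) ^ k))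
      \<longlonglongrightarrow> - 0 - 2 * sqrt 5 * 0"
    using r by (intro tendsto_intros powser_times_n_limit_0) simp_all
  then have "(\<lambda>k. real k * x k) \<longlonglongrightarrow> 0"
    by (simp add: x_def algebra_simps)
  then have "(\<lambda>k. real k * ln (1 + x k)) \<longlonglongrightarrow> 0"
    by (rule tendsto_times_ln_one_plus)
  moreover have "eventually (\<lambda>k. real k * ln (1 + x k) =
      real k * (ln (real (fib k) - 2) - real k * ln \<tau> + ln (sqrt 5))) sequentially"
    using eventually_ge_at_top[of 4]
  proof eventually_elim
    case (elim k)
    have "3 \<le> fib k" using fib_mono[OF elim] by (simp add: eval_nat_numeral)
    then have pos: "real (fib k) - 2 > 0" by linarith
    have "real (fib k) = (\<tau> ^ k - \<psi> ^ k) / sqrt 5"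
      unfolding \<tau>_def \<psi>_def by (rule fib_closed_form)
    then have "1 + x k = (real (fib k) - 2) * sqrt 5 / \<tau> ^ k"
      using \<tau> by (simp add: x_def power_divide field_simps)
    then have "ln (1 + x k) = ln (real (fib k) - 2) + ln (sqrt 5) - real k * ln \<tau>"
      using pos \<tau> by (simp add: ln_div ln_mult ln_realpow)
    then show ?case by simp
  qed
  ultimately show ?thesis by (rule Lim_transform_eventually)
qed

lemma fib_prefix_bound_tendsto:
  fixes \<tau> c :: real
  defines "\<tau> \<equiv> (1 + sqrt 5) / 2"
  defines "c \<equiv> 3 + \<tau>\<^sup>2 / 2 - ln (2 * sqrt 5) / ln \<tau>"
  shows "(\<lambda>s. let x = fib_prefix s; n = real (length x); e = ice x
              in e / 2 + 1 + ln (n / 2) / ln (e / (e - 1)) - (real s + c)) \<longlonglongrightarrow> 0"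
proof -
  have s5: "sqrt 5 > 2" by (auto intro: real_less_rsqrt)
  have \<tau>: "\<tau> > 1" using s5 by (simp add: \<tau>_def)
  have \<tau>2: "\<tau>\<^sup>2 = \<tau> + 1" by (simp add: \<tau>_def power2_eq_square field_simps)
  define N where "N k = real (fib k) - 2" for k
  define h where "h k = ln (N k) - real k * ln \<tau> + ln (sqrt 5)" for k
  \<comment> \<open>\<open>D s\<close> will be \<open>ln (e / (e - 1))\<close>. \<open>R s\<close>
    equals \<open>h (s + 2) - (s + 2) * (h (s + 2) - h (s + 1))\<close>, expanded so that each term
    is a shift of \<open>h k\<close> or \<open>k * h k\<close>, up to sign.\<close>
  define D where "D s = ln \<tau> + h (s + 2) - h (s + 1)" for s
  define R where "R s = h (s + 2) + h (s + 1) - real (s + 2) * h (s + 2)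
      + real (s + 1) * h (s + 1)" for s
  have kh: "(\<lambda>k. real k * h k) \<longlonglongrightarrow> 0"
    using ln_fib_minus_two_asymptotics by (simp add: h_def N_def \<tau>_def)
  have "(\<lambda>k. (real k * h k) * (1 / real k)) \<longlonglongrightarrow> 0 * 0"
    by (intro tendsto_mult kh lim_1_over_n)
  moreover have "eventually (\<lambda>k. (real k * h k) * (1 / real k) = h k) sequentially"
    using eventually_gt_at_top[of 0] by eventually_elim simp
  ultimately have "h \<longlonglongrightarrow> 0 * 0" by (rule Lim_transform_eventually)
  then have h: "h \<longlonglongrightarrow> 0" by simp
  note shifts = LIMSEQ_ignore_initial_segment[OF h] LIMSEQ_ignore_initial_segment[OF kh]
  have "D \<longlonglongrightarrow> ln \<tau> + 0 - 0"
    unfolding D_def by (intro tendsto_intros shifts)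
  then have D: "D \<longlonglongrightarrow> ln \<tau>" by simp
  have "R \<longlonglongrightarrow> 0 + 0 - 0 + 0"
    unfolding R_def by (intro tendsto_intros shifts)
  then have R: "R \<longlonglongrightarrow> 0" by simp
  \<comment> \<open>The target expression with \<open>s\<close> already cancelled; the 3 collects
    the summand 1 and the 2 from \<open>s + 2\<close>.\<close>
  have "(\<lambda>s. exp (D s) / (exp (D s) - 1) / 2 + 3 + R s / D s - ln (2 * sqrt 5) / D s - c)
      \<longlonglongrightarrow> exp (ln \<tau>) / (exp (ln \<tau>) - 1) / 2 + 3 + 0 / ln \<tau> - ln (2 * sqrt 5) / ln \<tau> - c"
    using \<tau> by (intro tendsto_intros D R) auto
  also have "exp (ln \<tau>) / (exp (ln \<tau>) - 1) = \<tau>\<^sup>2"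
    using \<tau> \<tau>2 by (simp add: field_simps power2_eq_square)
  finally have lim: "(\<lambda>s. exp (D s) / (exp (D s) - 1) / 2 + 3 + R s / D s
      - ln (2 * sqrt 5) / D s - c) \<longlonglongrightarrow> 0"
    by (simp add: c_def)
  show ?thesis
  proof (rule Lim_transform_eventually[OF lim])
    show "eventually (\<lambda>s. exp (D s) / (exp (D s) - 1) / 2 + 3 + R s / D s
        - ln (2 * sqrt 5) / D s - c =
        (let x = fib_prefix s; n = real (length x); e = ice x
         in e / 2 + 1 + ln (n / 2) / ln (e / (e - 1)) - (real s + c))) sequentially"
      using eventually_ge_at_top[of 3]
    proof eventually_elim
      case (elim s)
      have F: "real (fib s) > 0" using fib_neq_0_nat[of s] elim by simp
      have rec: "N (Suc (Suc s)) = N (Suc s) + real (fib s)" by (simp add: N_def)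
      have "3 \<le> fib (s + 1)" using fib_mono[of 4 "s + 1"] elim by (simp add: eval_nat_numeral)
      then have N1: "N (s + 1) > 0" by (simp add: N_def)
      then have N2: "N (s + 2) > 0" using rec F by simp
      define e where "e = ice (fib_prefix s)"
      have e: "e = N (s + 2) / real (fib s)"
        unfolding e_def N_def using elim by (intro ice_fib_prefix) simp
      have len: "real (length (fib_prefix s)) = N (s + 2)"
        using N2 by (simp add: fib_prefix_def N_def of_nat_diff del: fib.simps add_2_eq_Suc')
      \<comment> \<open>By \<open>rec\<close>, \<open>e - 1\<close> is
        \<open>N (s + 1) / fib s\<close>.\<close>
      have q: "e / (e - 1) = N (s + 2) / N (s + 1)"
        using F N1 by (simp add: e rec field_simps)
      have lnq: "ln (N (s + 2) / N (s + 1)) = D s"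
        using N1 N2 by (simp add: ln_div D_def h_def algebra_simps)
      have expD: "exp (D s) = N (s + 2) / N (s + 1)"
        unfolding lnq[symmetric] using N1 N2 by simp
      have De: "exp (D s) / (exp (D s) - 1) = e"
        using F N1 by (simp add: expD e rec field_simps)
      have "exp (D s) \<noteq> 1" using F N1 by (simp add: expD rec)
      then have D0: "D s \<noteq> 0" by auto
      have "ln (N (s + 2) / 2) = real (s + 2) * D s + R s - ln (2 * sqrt 5)"
        using N2 by (simp add: ln_div ln_mult D_def R_def h_def algebra_simps)
      then have "ln (N (s + 2) / 2) / D s = real (s + 2) + R s / D s - ln (2 * sqrt 5) / D s"
        using D0 by (simp add: add_divide_distrib diff_divide_distrib)
      then show ?case
        unfolding Let_def e_def[symmetric] len q lnq De by simp
    qed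
  qed
qed

section \<open>Numerical value of the constant\<close>

lemma ln_golden_ratio_bounds: "ln ((1 + sqrt 5) / 2) \<in> {0.4812117..0.4812120 :: real}"
proof -
  \<comment> \<open>\<open>6765 / 4181\<close> and \<open>4181 / 2584\<close> are quotients of consecutive Fibonacci numbers, hence
    lower and upper convergents of the golden ratio.\<close>
  have "sqrt 5 \<ge> 9349 / 4181" "sqrt 5 \<le> 5778 / 2584"
    by (rule real_le_rsqrt real_le_lsqrt; simp add: power2_eq_square)+
  then have "ln (6765 / 4181) \<le> ln ((1 + sqrt 5) / 2)" "ln ((1 + sqrt 5) / 2) \<le> ln (4181 / 2584)"
    by (subst ln_le_cancel_iff; simp)+
  moreover have "ln (6765 / 4181) \<ge> (0.4812117 :: real)"
    using ln_approx_bounds[of "6765 / 4181" 5] by (simp add: eval_nat_numeral)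
  moreover have "ln (4181 / 2584) \<le> (0.4812120 :: real)"
    using ln_approx_bounds[of "4181 / 2584" 5] by (simp add: eval_nat_numeral)
  ultimately show ?thesis by simp
qed

text \<open>Needed because \<open>ln (2 * sqrt 5)\<close> is half of \<open>ln 20\<close>. Factoring
  20 keeps the arguments of \<open>ln_approx_bounds\<close> small, so few terms suffice.\<close>

lemma ln_20_bounds: "ln 20 \<in> {2.9957321..2.9957325 :: real}"
proof -
  have "ln (20 :: real) = ln (2 ^ 4 * (5 / 4))" by simp
  also have "\<dots> = 4 * ln 2 + ln (5 / 4)"
    by (subst ln_mult) (simp_all add: ln_realpow del: power_numeral)
  finally have "ln (20 :: real) = 4 * ln 2 + ln (5 / 4)" .
  moreover have "ln 2 \<in> {0.69314717..0.69314719 :: real}"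
    using ln_approx_bounds[of 2 8] by (simp add: eval_nat_numeral)
  moreover have "ln (5 / 4) \<in> {0.22314354..0.22314358 :: real}"
    using ln_approx_bounds[of "5 / 4" 4] by (simp add: eval_nat_numeral)
  ultimately show ?thesis by simp
qed

lemma fib_prefix_constant_approx:
  fixes \<tau> :: real
  defines "\<tau> \<equiv> (1 + sqrt 5) / 2"
  shows "\<bar>3 + \<tau>\<^sup>2 / 2 - ln (2 * sqrt 5) / ln \<tau> - 1.19632\<bar> \<le> 0.000005"
proof -
  have L: "ln \<tau> \<ge> 0.4812117" "ln \<tau> \<le> 0.4812120"
    using ln_golden_ratio_bounds by (simp_all add: \<tau>_def)
  have "2 * sqrt 5 = sqrt 20" by (simp add: real_sqrt_mult[of 4 5, simplified])
  then have ln: "ln (2 * sqrt 5) = ln 20 / 2" by (simp add: ln_sqrt)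
  have s5: "sqrt 5 \<ge> 2.2360679" "sqrt 5 \<le> 2.236068"
    by (rule real_le_rsqrt real_le_lsqrt; simp add: power2_eq_square)+
  have \<tau>2: "\<tau>\<^sup>2 = (3 + sqrt 5) / 2" by (simp add: \<tau>_def power2_eq_square field_simps)
  define r where "r = ln 20 / 2 / ln \<tau>"
  \<comment> \<open>Since \<open>(3 + sqrt 5) / 4\<close> is about 1.309017, these bounds place the
    constant roughly between 1.196318 and 1.196324.\<close>
  have "r \<le> 3.112699"
    unfolding r_def using L ln_20_bounds by (subst pos_divide_le_eq) auto
  moreover have "r \<ge> 3.112693"
    unfolding r_def using L ln_20_bounds by (subst pos_le_divide_eq) auto
  ultimately have "\<bar>3 + (3 + sqrt 5) / 2 / 2 - r - 1.19632\<bar> \<le> 0.000005"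
    unfolding abs_le_iff using s5 by (auto simp: field_simps)
  then show ?thesis by (simp only: ln \<tau>2 r_def)
qed

theorem theorem12:
  shows "let \<tau> = (1 + sqrt 5) / 2;
             c = 3 + \<tau>\<^sup>2 / 2 - ln (2 * sqrt 5) / ln \<tau>
         in (\<forall>s\<ge>4. nnp (fib_prefix s) = s - 2) \<and>
            (\<lambda>s. let x = fib_prefix s; n = real (length x); e = ice x
                 in e / 2 + 1 + ln (n / 2) / ln (e / (e - 1)) - (real s + c))
              \<longlonglongrightarrow> 0 \<and>
            \<bar>c - 1.19632\<bar> \<le> 0.000005"
  using nnp_fib_prefix fib_prefix_bound_tendsto fib_prefix_constant_approx
  unfolding Let_def by auto

end
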